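(* Let $n,m$ be positive integers such that $1<m<n$. Let $k=n-m$. Then $\kappa_V(G)\geq k$ for any $k$-critical-bipartite graph $G=(U,V;E)$ with $|U|=n$ and $|V|=m$.
   Context: All graphs are finite, simple and undirected. $G=(U,V;E)$ denotes a bipartite graph with color classes $U,V$ and edge set $E$. A bipartite graph $G=(U,V;E)$ with $k=|U|-|V|\ge 0$ is $k$-critical-bipartite if, after deleting any $k$ vertices from $U$, the remaining subgraph has a perfect matching. A vertex cut separating two vertices $u,v$ of the same component of $G$ is a set $Z\subseteq V(G)$ of vertices whose removal leaves $u$ and $v$ (neither in $Z$) in different components of $G-Z$. For a set $S\subseteq V(G)$ of vertices, the set connectivity $\kappa_S(G)$ is the size of a smallest vertex cut separating some two vertices $u,v\in S$. In particular $\kappa_V(G)$ is the set connectivity of the color class $V$. *)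

theory Defs
  imports "Graph_Theory.Digraph_Component"
begin

text \<open>
  Finite simple undirected graphs are those of the locale \<^locale>\<open>graph\<close>: finite digraphs without
  loops and parallel arcs whose arc relation is symmetric. An undirected edge is thus a pair of
  opposite arcs, adjacency of \<open>x\<close> and \<open>y\<close> is \<open>x \<rightarrow>\<^bsub>G\<^esub> y\<close>, and \<open>x\<close> and \<open>y\<close> lie in the same component
  iff \<open>x \<rightarrow>\<^sup>*\<^bsub>G\<^esub> y\<close>.
\<close>

locale bipartite_graph = graph G
  for G :: "('a, 'b) pre_digraph" and U V :: "'a set" +
  assumes verts_eq: "verts G = U \<union> V"
    and classes_disjoint: "U \<inter> V = {}"
    and edge_between: "x \<rightarrow>\<^bsub>G\<^esub> y \<Longrightarrow> x \<in> U \<and> y \<in> V \<or> x \<in> V \<and> y \<in> U"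

definition delete_vertices :: "('a, 'b) pre_digraph \<Rightarrow> 'a set \<Rightarrow> ('a, 'b) pre_digraph" where
  "delete_vertices G Z = G \<restriction> (verts G - Z)"

text \<open>A set of undirected edges is given here as a symmetric relation.\<close>

definition perfect_matching :: "('a, 'b) pre_digraph \<Rightarrow> 'a rel \<Rightarrow> bool" where
  "perfect_matching G M \<longleftrightarrow>
     M \<subseteq> arcs_ends G \<and> sym M \<and> (\<forall>x \<in> verts G. \<exists>!y. (x, y) \<in> M)"

definition critical_bipartite :: "nat \<Rightarrow> ('a, 'b) pre_digraph \<Rightarrow> 'a set \<Rightarrow> 'a set \<Rightarrow> bool" where
  "critical_bipartite k G U V \<longleftrightarrow>
     bipartite_graph G U V \<and> card U = card V + k \<and>
     (\<forall>W. W \<subseteq> U \<and> card W = k \<longrightarrow> (\<exists>M. perfect_matching (delete_vertices G W) M))"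

definition vertex_cut :: "('a, 'b) pre_digraph \<Rightarrow> 'a \<Rightarrow> 'a \<Rightarrow> 'a set \<Rightarrow> bool" where
  "vertex_cut G u v Z \<longleftrightarrow>
     u \<rightarrow>\<^sup>*\<^bsub>G\<^esub> v \<and>
     Z \<subseteq> verts G \<and> u \<in> verts G - Z \<and> v \<in> verts G - Z \<and>
     \<not> u \<rightarrow>\<^sup>*\<^bsub>delete_vertices G Z\<^esub> v"

text \<open>
  If no two vertices of \<open>S\<close> can be separated, this is the infimum of the empty set of naturals,
  an unspecified number (not infinity), so no positive lower bound is provable for lack of cuts.
\<close>

definition set_connectivity :: "'a set \<Rightarrow> ('a, 'b) pre_digraph \<Rightarrow> nat" (\<open>\<kappa>\<^bsub>_\<^esub>\<close>) where
  "\<kappa>\<^bsub>S\<^esub> G = Inf {card Z | Z. \<exists>u \<in> S. \<exists>v \<in> S. vertex_cut G u v Z}"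

end

theory Submission
  imports Defs
begin

text \<open>
  Criticality yields the strengthened Hall condition \<open>|N(X)| \<ge> |X| + k\<close> for every nonempty
  \<open>X \<subseteq> V\<close>: delete \<open>k\<close> vertices of \<open>U\<close>, as many of them as possible from \<open>N(X)\<close>. If \<open>Z\<close> separates two
  vertices of \<open>V\<close>, split \<open>V - Z\<close> into the vertices \<open>A\<close> reachable from the first one and the rest \<open>B\<close>.
  Then \<open>N(A) \<inter> N(B) \<subseteq> Z\<close>, so adding the Hall conditions of \<open>A\<close> and \<open>B\<close> gives \<open>|Z| \<ge> k\<close>.
\<close>

lemma verts_delete_vertices: "verts (delete_vertices G Z) = verts G - Z"
  by (simp add: delete_vertices_def)

lemma dominates_delete_vertices:
  assumes "wf_digraph G"
  shows "x \<rightarrow>\<^bsub>delete_vertices G Z\<^esub> y \<longleftrightarrow> x \<rightarrow>\<^bsub>G\<^esub> y \<and> x \<notin> Z \<and> y \<notin> Z"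
  using wf_digraph.wellformed[OF assms]
  by (auto simp: delete_vertices_def arcs_ends_conv image_iff)

lemma wf_digraph_delete_vertices:
  assumes "wf_digraph G"
  shows "wf_digraph (delete_vertices G Z)"
  unfolding delete_vertices_def by (rule wf_digraph.wellformed_induce_subgraph[OF assms])

lemma delete_vertices_empty:
  assumes "wf_digraph G"
  shows "delete_vertices G {} = G"
  using wf_digraph.wellformed[OF assms]
  by (auto simp: delete_vertices_def induce_subgraph_def intro!: pre_digraph.equality)

text \<open>Sending each vertex to its partner maps \<open>X\<close> into its neighbourhood. The map
  is injective because \<open>M\<close> is symmetric and partners are unique. Finiteness excludes
  the default value 0 of \<open>card\<close>.\<close>

lemma perfect_matching_card_neighbours:
  assumes "wf_digraph G" "perfect_matching G M" "X \<subseteq> verts G" "finite (arcs_ends G `` X)"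
  shows "card X \<le> card (arcs_ends G `` X)"
proof -
  have M: "M \<subseteq> arcs_ends G" "sym M" "\<And>x. x \<in> verts G \<Longrightarrow> \<exists>!y. (x, y) \<in> M"
    using assms(2) by (auto simp: perfect_matching_def)
  obtain f where f: "\<And>x. x \<in> verts G \<Longrightarrow> (x, f x) \<in> M"
    using M(3) by metis
  have "inj_on f (verts G)"
  proof (rule inj_onI)
    fix x x' assume x: "x \<in> verts G" "x' \<in> verts G" "f x = f x'"
    then have "(f x, x) \<in> M" "(f x, x') \<in> M"
      using f M(2) by (metis symD)+
    moreover have "f x \<in> verts G"
      using f[OF x(1)] M(1) wf_digraph.adj_in_verts(2)[OF assms(1)] by blast
    ultimately show "x = x'"
      using M(3) by blast
  qed
  then have "inj_on f X"
    using assms(3) by (rule inj_on_subset)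
  moreover have "f ` X \<subseteq> arcs_ends G `` X"
    using f M(1) assms(3) by blast
  ultimately show ?thesis
    using assms(4) by (rule card_inj_on_le)
qed

lemma (in bipartite_graph) finite_classes: "finite U" "finite V"
  using finite_verts by (auto simp: verts_eq)

lemma (in bipartite_graph) neighbours_subset:
  assumes "X \<subseteq> V"
  shows "arcs_ends G `` X \<subseteq> U"
  using assms edge_between classes_disjoint by blast

lemma critical_bipartite_hall:
  assumes crit: "critical_bipartite k G U V" and X: "X \<subseteq> V" "X \<noteq> {}"
  shows "card X + k \<le> card (arcs_ends G `` X)"
proof -
  interpret bipartite_graph G U V
    using crit by (simp add: critical_bipartite_def)
  let ?N = "arcs_ends G `` X"
  have N: "?N \<subseteq> U" "finite ?N"
    using neighbours_subset[OF X(1)] finite_classes finite_subset by auto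
  have "k \<le> card U"
    using crit by (simp add: critical_bipartite_def)
  \<comment> \<open>Comparability with \<open>?N\<close> makes \<open>W\<close> delete as many
    neighbours as possible: all of them if there are at most \<open>k\<close>, otherwise exactly
    \<open>k\<close>.\<close>
  have "\<exists>W \<subseteq> U. card W = k \<and> (?N \<subseteq> W \<or> W \<subseteq> ?N)"
  proof (cases "card ?N \<le> k")
    case True
    then show ?thesis
      using exists_subset_between[of ?N k U] N \<open>k \<le> card U\<close> finite_classes by blast
  next
    case False
    then obtain W where "W \<subseteq> ?N" "card W = k"
      by (meson obtain_subset_with_card_n nat_le_linear)
    then show ?thesis
      using N(1) by blast
  qed
  then obtain W where W: "W \<subseteq> U" "card W = k" "?N \<subseteq> W \<or> W \<subseteq> ?N"
    by blast
  let ?H = "delete_vertices G W"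
  obtain M where "perfect_matching ?H M"
    using crit W by (auto simp: critical_bipartite_def)
  moreover have "X \<subseteq> verts ?H"
    using X(1) W(1) classes_disjoint by (auto simp: verts_delete_vertices verts_eq)
  \<comment> \<open>\<open>W\<close> lies in \<open>U\<close>, so the deletion leaves
    \<open>X\<close> intact and costs it only the neighbours in \<open>W\<close>.\<close>
  moreover have "arcs_ends ?H `` X = ?N - W"
    using X(1) W(1) classes_disjoint
    unfolding Image_def Bex_def dominates_delete_vertices[OF wf_digraph] by auto
  ultimately have le: "card X \<le> card (?N - W)"
    using perfect_matching_card_neighbours[OF wf_digraph_delete_vertices[OF wf_digraph], of W M X]
      N(2) by simp
  \<comment> \<open>If \<open>W\<close> swallowed \<open>?N\<close>, the nonempty \<open>X\<close>
    would have no partners left; this leaves the case \<open>W \<subseteq> ?N\<close>.\<close>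
  have "0 < card X"
    using X finite_classes(2) finite_subset by (auto simp: card_gt_0_iff)
  then have "\<not> ?N \<subseteq> W"
    using le by (metis Diff_eq_empty_iff card.empty le_zero_eq less_irrefl)
  then have "W \<subseteq> ?N"
    using W(3) by blast
  then have "card (?N - W) = card ?N - k" "k \<le> card ?N"
    using W(2) N(2) by (auto simp: card_Diff_subset finite_subset card_mono)
  then show ?thesis
    using le by linarith
qed

text \<open>Phrased by non-reachability instead of \<open>vertex_cut\<close>, so that it can also be
  applied to \<open>Z = {}\<close> to derive connectedness.\<close>

lemma critical_bipartite_separator_card:
  assumes crit: "critical_bipartite k G U V"
    and Z: "Z \<subseteq> verts G" and u: "u \<in> V - Z" and v: "v \<in> V - Z"
    and sep: "\<not> u \<rightarrow>\<^sup>*\<^bsub>delete_vertices G Z\<^esub> v"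
  shows "k \<le> card Z"
proof -
  interpret bipartite_graph G U V
    using crit by (simp add: critical_bipartite_def)
  let ?H = "delete_vertices G Z" and ?N = "\<lambda>X. arcs_ends G `` X"
  interpret H: wf_digraph ?H
    by (rule wf_digraph_delete_vertices[OF wf_digraph])
  define A where "A = {x \<in> V - Z. u \<rightarrow>\<^sup>*\<^bsub>?H\<^esub> x}"
  define B where "B = V - Z - A"
  \<comment> \<open>Reachability is reflexive only on vertices of the digraph, so
    \<open>u \<in> A\<close> depends on this.\<close>
  have "u \<in> verts ?H"
    using u by (auto simp: verts_delete_vertices verts_eq)
  then have "u \<in> A" "v \<in> B"
    using u v sep by (auto simp: A_def B_def)
  moreover have "A \<subseteq> V" "B \<subseteq> V"
    by (auto simp: A_def B_def)
  ultimately have hall: "card A + k \<le> card (?N A)" "card B + k \<le> card (?N B)"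
    using critical_bipartite_hall[OF crit] by blast+
  have fin: "finite A" "finite B" "finite Z"
    using finite_classes(2) finite_subset[OF Z] by (auto simp: A_def B_def)
  have N: "?N A \<subseteq> U" "?N B \<subseteq> U"
    using \<open>A \<subseteq> V\<close> \<open>B \<subseteq> V\<close> by (simp_all only: neighbours_subset)
  have finN: "finite (?N A)" "finite (?N B)"
    using N finite_classes(1) by (blast intro: finite_subset)+
  \<comment> \<open>A common neighbour outside \<open>Z\<close> would extend a walk from
    \<open>u\<close> to \<open>a\<close> as far as \<open>b\<close>, contradicting
    \<open>b \<in> B\<close>.\<close>
  have "?N A \<inter> ?N B \<subseteq> U \<inter> Z"
  proof
    fix y assume y: "y \<in> ?N A \<inter> ?N B"
    then obtain a b where ab: "a \<in> A" "b \<in> B" "a \<rightarrow>\<^bsub>G\<^esub> y" "b \<rightarrow>\<^bsub>G\<^esub> y"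
      by blast
    have "y \<in> Z"
    proof (rule ccontr)
      assume "y \<notin> Z"
      moreover have "y \<rightarrow>\<^bsub>G\<^esub> b"
        using ab(4) arcs_ends_symmetric[OF sym_arcs] by blast
      ultimately have "a \<rightarrow>\<^bsub>?H\<^esub> y" "y \<rightarrow>\<^bsub>?H\<^esub> b"
        using ab by (auto simp: A_def B_def dominates_delete_vertices[OF wf_digraph])
      moreover have "u \<rightarrow>\<^sup>*\<^bsub>?H\<^esub> a"
        using ab(1) by (simp add: A_def)
      ultimately have "u \<rightarrow>\<^sup>*\<^bsub>?H\<^esub> b"
        by (blast intro: H.reachable_adj_trans)
      then show False
        using ab(2) by (auto simp: A_def B_def)
    qed
    then show "y \<in> U \<inter> Z"
      using y N(1) by blast
  qed
  \<comment> \<open>The two Hall bounds sum to \<open>card V - card (V \<inter> Z) + 2 * k\<close>,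
    while the neighbourhoods together have size at most \<open>card U + card (U \<inter> Z)\<close>.
    Since \<open>card U = card V + k\<close>, one \<open>k\<close> cancels and the other is bounded
    by \<open>card Z\<close>.\<close>
  then have "card (?N A \<inter> ?N B) \<le> card (U \<inter> Z)"
    using fin(3) by (simp add: card_mono)
  moreover have "card (?N A \<union> ?N B) \<le> card U"
    using N finite_classes(1) by (simp add: card_mono)
  moreover have "card (?N A) + card (?N B) = card (?N A \<union> ?N B) + card (?N A \<inter> ?N B)"
    using finN by (rule card_Un_Int)
  moreover have "card U = card V + k"
    using crit by (simp add: critical_bipartite_def)
  moreover have "card V = card A + card B + card (V \<inter> Z)"
  proof -
    have "V = (A \<union> B) \<union> (V \<inter> Z)" "(A \<union> B) \<inter> (V \<inter> Z) = {}" "A \<inter> B = {}"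
      by (auto simp: A_def B_def)
    then show ?thesis
      using fin by (metis card_Un_disjoint finite_Int finite_Un)
  qed
  moreover have "card Z = card (U \<inter> Z) + card (V \<inter> Z)"
  proof -
    have "Z = (U \<inter> Z) \<union> (V \<inter> Z)" "(U \<inter> Z) \<inter> (V \<inter> Z) = {}"
      using Z classes_disjoint by (auto simp: verts_eq)
    then show ?thesis
      using fin by (metis card_Un_disjoint finite_Int)
  qed
  ultimately show ?thesis
    using hall by linarith
qed

text \<open>Otherwise the empty set would be a separator with fewer than \<open>k\<close>
  elements.\<close>

lemma critical_bipartite_connected:
  assumes "critical_bipartite k G U V" "0 < k" "u \<in> V" "v \<in> V"
  shows "u \<rightarrow>\<^sup>*\<^bsub>G\<^esub> v"
proof -
  interpret bipartite_graph G U V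
    using assms(1) by (simp add: critical_bipartite_def)
  show ?thesis
    using critical_bipartite_separator_card[OF assms(1), of "{}" u v] assms
    by (auto simp: delete_vertices_empty[OF wf_digraph])
qed

text \<open>Without \<open>U\<close> no arc leaves \<open>u\<close>, so a walk from \<open>u\<close>
  cannot take a first step. This supplies a cut between any two connected vertices of
  \<open>V\<close>.\<close>

lemma (in bipartite_graph) not_reachable_delete_class:
  assumes "u \<in> V" "u \<noteq> v"
  shows "\<not> u \<rightarrow>\<^sup>*\<^bsub>delete_vertices G U\<^esub> v"
proof
  assume "u \<rightarrow>\<^sup>*\<^bsub>delete_vertices G U\<^esub> v"
  then show False
    using assms
    by (cases rule: pre_digraph.converse_reachable_cases)
      (auto simp: dominates_delete_vertices[OF wf_digraph] dest: edge_between)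
qed

theorem theorem5p1:
  fixes n m k :: nat
    and G :: "('a, 'b) pre_digraph"
    and U V :: "'a set"
  assumes "1 < m" and "m < n"
    and "k = n - m"
    and "critical_bipartite k G U V"
    and "card U = n" and "card V = m"
  shows "\<kappa>\<^bsub>V\<^esub> G \<ge> k"
proof -
  interpret bipartite_graph G U V
    using assms(4) by (simp add: critical_bipartite_def)
  let ?C = "{card Z | Z. \<exists>u \<in> V. \<exists>v \<in> V. vertex_cut G u v Z}"
  obtain u v where uv: "u \<in> V" "v \<in> V" "u \<noteq> v"
    using assms(1,6) by (metis card_le_Suc0_iff_eq finite_classes(2) One_nat_def not_le)
  \<comment> \<open>A cut must separate vertices of one component; \<open>m < n\<close> makes
    \<open>k\<close> positive, which yields that connection.\<close>
  have "vertex_cut G u v U"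
    using uv not_reachable_delete_class critical_bipartite_connected[OF assms(4)] assms(2,3)
      classes_disjoint
    by (auto simp: vertex_cut_def verts_eq)
  \<comment> \<open>The infimum of the empty set would be unspecified.\<close>
  then have "?C \<noteq> {}"
    using uv by blast
  then have "Inf ?C \<in> ?C"
    by (rule Inf_nat_def1)
  then obtain Z u v where "Inf ?C = card Z" "u \<in> V" "v \<in> V" "vertex_cut G u v Z"
    by blast
  then show ?thesis
    using critical_bipartite_separator_card[OF assms(4), of Z u v]
    by (auto simp: set_connectivity_def vertex_cut_def)
qed

end
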